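(* Let $\alpha: G \to \mathrm{Aut}(A)$ be an action of a discrete group $G$ on a unital $C^*$-algebra $A$, let $u$ be an $\alpha$-equivariant action of $G$ on a Hilbert $A$-module $X$, let $c: G\to X$ be a one-cocycle (w.r.t. $u$), and suppose that $c$ is symmetric (resp. central). Let $\psi: G\to A^+$ (resp. $\psi: G\to Z(A)^+$) be defined by $$\psi(g) = \langle c(g),c(g)\rangle, \quad g\in G.$$ Then $\psi$ is a normalized $\alpha$-negative definite function.
   Context: Notation: $A_{\mathrm{sa}}$, $A^+$, $Z(A)$ denote the self-adjoint part, the positive cone and the center of $A$; $Z(A)^+ = Z(A)\cap A^+$; $e$ is the identity of $G$. A Hilbert $A$-module is a right Hilbert $C^*$-module over $A$ (with $A$-valued inner product linear in the second variable). An $\alpha$-equivariant action $u$ of $G$ on a Hilbert $A$-module $X$ is a homomorphism $g\mapsto u_g$ from $G$ into the group of bijective $\mathbb{C}$-linear isometries from $X$ onto itself such that $\alpha_g(\langle x,y\rangle) = \langle u_g x, u_g y\rangle$ and $u_g(x\cdot a) = (u_g x)\cdot \alpha_g(a)$ for all $g\in G$, $x,y\in X$, $a\in A$. A one-cocycle (w.r.t. $u$) is a map $c: G\to X$ with $c(gh) = c(g)+u_g(c(h))$ for all $g,h\in G$. It is symmetric if $\langle c(g),c(h)\rangle \in A_{\mathrm{sa}}$ for all $g,h\in G$, and central if $\langle c(g),c(h)\rangle\in Z(A)$ for all $g,h\in G$. A function $\psi: G\to A$ is $\alpha$-negative definite if $\alpha_g(\psi(g^{-1})) = \psi(g)^*$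 for all $g\in G$ and, for any $n\in\mathbb{N}$, $g_1,\dots,g_n\in G$ and $b_1,\dots,b_n\in A$ with $\sum_{i=1}^n b_i = 0$, one has $\sum_{i,j=1}^n b_i^*\,\alpha_{g_i}\big(\psi(g_i^{-1}g_j)\big)\,b_j \leq 0$ in $A$. It is normalized if $\psi(e)=0$. *)

theory Defs
  imports Complex_Main "HOL-Algebra.Group"
begin

section \<open>Complex normed spaces\<close>

text \<open>
  The library has no classes for complex vector spaces. As usual, they are introduced on top of the
  real ones, the real structure being the restriction of the complex one.
\<close>

class complex_vector = real_vector +
  fixes scaleC :: "complex \<Rightarrow> 'a \<Rightarrow> 'a"  (infixr \<open>*\<^sub>C\<close> 75)
  assumes scaleC_add_right: "c *\<^sub>C (x + y) = c *\<^sub>C x + c *\<^sub>C y"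
    and scaleC_add_left: "(c + d) *\<^sub>C x = c *\<^sub>C x + d *\<^sub>C x"
    and scaleC_scaleC: "c *\<^sub>C (d *\<^sub>C x) = (c * d) *\<^sub>C x"
    and scaleR_scaleC: "r *\<^sub>R x = complex_of_real r *\<^sub>C x"

lemma vector_space_scaleC: "vector_space (scaleC :: complex \<Rightarrow> 'a::complex_vector \<Rightarrow> 'a)"
proof
  show "1 *\<^sub>C x = x" for x :: 'a
    using scaleR_scaleC[of 1 x] by simp
qed (simp_all add: scaleC_add_right scaleC_add_left scaleC_scaleC)

abbreviation clinear :: "('a::complex_vector \<Rightarrow> 'b::complex_vector) \<Rightarrow> bool"
  where "clinear \<equiv> Vector_Spaces.linear (*\<^sub>C) (*\<^sub>C)"

lemma clinear_iff:
  "clinear f \<longleftrightarrow> (\<forall>x y. f (x + y) = f x + f y) \<and> (\<forall>c x. f (c *\<^sub>C x) = c *\<^sub>C f x)"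
  by (simp add: Vector_Spaces.linear_iff vector_space_scaleC)

class complex_normed_vector = complex_vector + real_normed_vector +
  assumes norm_scaleC: "norm (c *\<^sub>C x) = cmod c * norm x"

class cbanach = complex_normed_vector + banach


section \<open>Unital C*-algebras\<close>

text \<open>
  The unit comes from \<^class>\<open>monoid_mult\<close>, and not from \<^class>\<open>ring_1\<close> or
  \<^class>\<open>real_normed_algebra_1\<close>, so that the zero algebra is not excluded.
\<close>

class cstar_algebra_1 = cbanach + real_normed_algebra + monoid_mult +
  fixes star :: "'a \<Rightarrow> 'a"  (\<open>_\<^sup>\<star>\<close> [1000] 999)
  assumes mult_scaleC_left: "(c *\<^sub>C x) * y = c *\<^sub>C (x * y)"
    and mult_scaleC_right: "x * (c *\<^sub>C y) = c *\<^sub>C (x * y)"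
    and star_star: "(x\<^sup>\<star>)\<^sup>\<star> = x"
    and star_add: "(x + y)\<^sup>\<star> = x\<^sup>\<star> + y\<^sup>\<star>"
    and star_scaleC: "(c *\<^sub>C x)\<^sup>\<star> = cnj c *\<^sub>C x\<^sup>\<star>"
    and star_mult: "(x * y)\<^sup>\<star> = y\<^sup>\<star> * x\<^sup>\<star>"
    and cstar_identity: "norm (x\<^sup>\<star> * x) = (norm x)\<^sup>2"

definition self_adjoint_part :: "'a::cstar_algebra_1 set"
  where "self_adjoint_part = {a. a\<^sup>\<star> = a}"

definition spectrum :: "'a::cstar_algebra_1 \<Rightarrow> complex set"
  where "spectrum a = {c. \<not> (\<exists>b. (c *\<^sub>C 1 - a) * b = 1 \<and> b * (c *\<^sub>C 1 - a) = 1)}"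

definition positive_cone :: "'a::cstar_algebra_1 set"
  where "positive_cone = {a \<in> self_adjoint_part. spectrum a \<subseteq> complex_of_real ` {0..}}"

definition cstar_le :: "'a::cstar_algebra_1 \<Rightarrow> 'a \<Rightarrow> bool"  (infix \<open>\<le>\<^sub>A\<close> 50)
  where "a \<le>\<^sub>A b \<longleftrightarrow> b - a \<in> positive_cone"

definition algebra_center :: "'a::cstar_algebra_1 set"
  where "algebra_center = {z. \<forall>a. z * a = a * z}"

definition star_automorphism :: "('a::cstar_algebra_1 \<Rightarrow> 'a) \<Rightarrow> bool"
  where "star_automorphism f \<longleftrightarrow>
    clinear f \<and> bij f \<and> (\<forall>a b. f (a * b) = f a * f b) \<and> (\<forall>a. f (a\<^sup>\<star>) = (f a)\<^sup>\<star>)"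

definition Aut_group :: "('a::cstar_algebra_1 \<Rightarrow> 'a) monoid"
  where "Aut_group = \<lparr>carrier = {f. star_automorphism f}, monoid.mult = (\<circ>), one = id\<rparr>"


section \<open>Hilbert modules, equivariant actions and cocycles\<close>

definition isometry_group :: "('x::complex_normed_vector \<Rightarrow> 'x) monoid"
  where "isometry_group =
    \<lparr>carrier = {f. clinear f \<and> bij f \<and> (\<forall>x. norm (f x) = norm x)}, monoid.mult = (\<circ>), one = id\<rparr>"

text \<open>
  The Hilbert module is the whole type \<open>'x\<close>; \<open>inner_norm\<close> makes its norm the one induced by the
  inner product, and completeness is part of \<^class>\<open>cbanach\<close>. Antilinearity of the inner product in
  the first variable follows from \<open>inner_linear\<close> and \<open>inner_star\<close>.
\<close>

locale hilbert_module =
  fixes act :: "'x::cbanach \<Rightarrow> 'a::cstar_algebra_1 \<Rightarrow> 'x"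
    and ip :: "'x \<Rightarrow> 'x \<Rightarrow> 'a"
  assumes act_linear_left: "clinear (\<lambda>x. act x a)"
    and act_linear_right: "clinear (\<lambda>a. act x a)"
    and act_mult: "act x (a * b) = act (act x a) b"
    and act_one: "act x 1 = x"
    and inner_linear: "clinear (\<lambda>y. ip x y)"
    and inner_act: "ip x (act y a) = ip x y * a"
    and inner_star: "ip y x = (ip x y)\<^sup>\<star>"
    and inner_positive: "ip x x \<in> positive_cone"
    and inner_definite: "ip x x = 0 \<Longrightarrow> x = 0"
    and inner_norm: "norm x = sqrt (norm (ip x x))"

definition equivariant_action ::
  "('g, 'm) monoid_scheme \<Rightarrow> ('g \<Rightarrow> 'a::cstar_algebra_1 \<Rightarrow> 'a) \<Rightarrow> ('x::cbanach \<Rightarrow> 'a \<Rightarrow> 'x) \<Rightarrow>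
    ('x \<Rightarrow> 'x \<Rightarrow> 'a) \<Rightarrow> ('g \<Rightarrow> 'x \<Rightarrow> 'x) \<Rightarrow> bool"
  where "equivariant_action G \<alpha> act ip u \<longleftrightarrow>
    u \<in> hom G isometry_group \<and>
    (\<forall>g\<in>carrier G. \<forall>x y. \<alpha> g (ip x y) = ip (u g x) (u g y)) \<and>
    (\<forall>g\<in>carrier G. \<forall>x a. u g (act x a) = act (u g x) (\<alpha> g a))"

definition one_cocycle ::
  "('g, 'm) monoid_scheme \<Rightarrow> ('g \<Rightarrow> 'x::cbanach \<Rightarrow> 'x) \<Rightarrow> ('g \<Rightarrow> 'x) \<Rightarrow> bool"
  where "one_cocycle G u c \<longleftrightarrow>
    (\<forall>g\<in>carrier G. \<forall>h\<in>carrier G. c (g \<otimes>\<^bsub>G\<^esub> h) = c g + u g (c h))"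

definition symmetric_cocycle ::
  "('g, 'm) monoid_scheme \<Rightarrow> ('x \<Rightarrow> 'x \<Rightarrow> 'a::cstar_algebra_1) \<Rightarrow> ('g \<Rightarrow> 'x) \<Rightarrow> bool"
  where "symmetric_cocycle G ip c \<longleftrightarrow>
    (\<forall>g\<in>carrier G. \<forall>h\<in>carrier G. ip (c g) (c h) \<in> self_adjoint_part)"

definition central_cocycle ::
  "('g, 'm) monoid_scheme \<Rightarrow> ('x \<Rightarrow> 'x \<Rightarrow> 'a::cstar_algebra_1) \<Rightarrow> ('g \<Rightarrow> 'x) \<Rightarrow> bool"
  where "central_cocycle G ip c \<longleftrightarrow>
    (\<forall>g\<in>carrier G. \<forall>h\<in>carrier G. ip (c g) (c h) \<in> algebra_center)"


section \<open>Negative definite functions\<close>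

definition negative_definite ::
  "('g, 'm) monoid_scheme \<Rightarrow> ('g \<Rightarrow> 'a::cstar_algebra_1 \<Rightarrow> 'a) \<Rightarrow> ('g \<Rightarrow> 'a) \<Rightarrow> bool"
  where "negative_definite G \<alpha> \<psi> \<longleftrightarrow>
    (\<forall>g\<in>carrier G. \<alpha> g (\<psi> (inv\<^bsub>G\<^esub> g)) = (\<psi> g)\<^sup>\<star>) \<and>
    (\<forall>(n::nat) \<gamma> b. \<gamma> \<in> {..<n} \<rightarrow> carrier G \<longrightarrow> (\<Sum>i<n. b i) = 0 \<longrightarrow>
      (\<Sum>i<n. \<Sum>j<n. (b i)\<^sup>\<star> * \<alpha> (\<gamma> i) (\<psi> (inv\<^bsub>G\<^esub> (\<gamma> i) \<otimes>\<^bsub>G\<^esub> \<gamma> j)) * b j) \<le>\<^sub>A 0)"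

definition normalized ::
  "('g, 'm) monoid_scheme \<Rightarrow> ('g \<Rightarrow> 'a::cstar_algebra_1) \<Rightarrow> bool"
  where "normalized G \<psi> \<longleftrightarrow> \<psi> \<one>\<^bsub>G\<^esub> = 0"

end

theory Submission
  imports Defs
begin

text \<open>
  Write \<open>x\<^sub>i = c \<gamma>\<^sub>i\<close>. The cocycle identity and equivariance give
  \<open>\<alpha>\<^bsub>\<gamma>i\<^esub> (\<psi> (\<gamma>\<^sub>i\<^sup>-\<^sup>1 \<gamma>\<^sub>j)) = \<langle>x\<^sub>j - x\<^sub>i, x\<^sub>j - x\<^sub>i\<rangle>\<close>. Expanding the inner product, the two terms
  that depend on a single index disappear from the sum because \<open>\<Sum> b\<^sub>i = 0\<close>, and what remains is
  \<open>- \<Sum> b\<^sub>i\<^sup>\<star> \<langle>x\<^sub>i, x\<^sub>j\<rangle> b\<^sub>j - \<Sum> b\<^sub>i\<^sup>\<star> \<langle>x\<^sub>j, x\<^sub>i\<rangle> b\<^sub>j\<close> (lemma \<open>distance_form_eq\<close>). The first sum is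
  \<open>\<langle>y, y\<rangle>\<close> for \<open>y = \<Sum> x\<^sub>i b\<^sub>i\<close>, hence positive. If the cocycle is symmetric, the second sum equals
  the first.

  If the cocycle is central, the second sum is the form of the transposed Gram matrix, which has
  entries in the center \<open>Z\<close> but is evaluated at vectors over the whole algebra. For vectors \<open>d\<close> over
  \<open>Z\<close> the transposition is undone by replacing \<open>d\<close> with \<open>d\<^sup>\<star>\<close>, so the form is positive there. The
  passage from \<open>Z\<close> to the whole algebra is elimination: after adding a small multiple of the
  identity matrix, the last diagonal entry is invertible, completing the square splits off
  a term \<open>a\<^sup>\<star> p a\<close> with \<open>p\<close> positive, and the Schur complement is again a matrix over \<open>Z\<close> that is
  positive on vectors over \<open>Z\<close> (lemmas \<open>hermitian_form_positive_strict\<close> and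
  \<open>hermitian_form_positive\<close>).

  This uses that positive elements, defined by their spectrum, form a closed convex cone that
  contains every \<open>a\<^sup>\<star> p a\<close> with \<open>p\<close> positive. These facts are derived from the axioms of
  a C*-algebra without Gelfand theory or the spectral radius formula. The main analytic tool is
  the binomial series, which gives a square root of \<open>1 - y\<close> whenever \<open>\<parallel>y\<parallel> \<le> 1\<close>. Lemma
  \<open>self_adjoint_norm_less_one\<close> uses such roots to bound norms by spectral data; it makes positivity
  of \<open>p\<close> equivalent to \<open>\<parallel>1 - \<epsilon> p\<parallel> \<le> 1\<close> for small \<open>\<epsilon> > 0\<close>, from which the cone properties and
  square roots of positive elements follow.
\<close>

section \<open>Arithmetic in a unital C*-algebra\<close>

lemma scaleC_simps [simp]:
  fixes x :: "'a::complex_vector"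
  shows "1 *\<^sub>C x = x" "0 *\<^sub>C x = 0" "c *\<^sub>C 0 = (0::'a)" "(- c) *\<^sub>C x = - (c *\<^sub>C x)"
    "c *\<^sub>C (- x) = - (c *\<^sub>C x)"
proof -
  interpret vector_space "scaleC :: complex \<Rightarrow> 'a \<Rightarrow> 'a" by (rule vector_space_scaleC)
  show "1 *\<^sub>C x = x" "0 *\<^sub>C x = 0" "c *\<^sub>C 0 = (0::'a)" "(- c) *\<^sub>C x = - (c *\<^sub>C x)"
    "c *\<^sub>C (- x) = - (c *\<^sub>C x)" by simp_all
qed

lemma scaleC_diff_right: "c *\<^sub>C (x - y) = c *\<^sub>C x - c *\<^sub>C (y::'a::complex_vector)"
  using scaleC_add_right[of c x "- y"] by simp

lemma star_scaleR: "(r *\<^sub>R x)\<^sup>\<star> = r *\<^sub>R (x::'a::cstar_algebra_1)\<^sup>\<star>"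
  by (simp add: scaleR_scaleC star_scaleC)

lemma star_minus [simp]: "(- x)\<^sup>\<star> = - (x::'a::cstar_algebra_1)\<^sup>\<star>"
  using star_scaleR[of "-1" x] by simp

lemma star_zero [simp]: "(0::'a::cstar_algebra_1)\<^sup>\<star> = 0"
  using star_scaleR[of 0 "0::'a"] by simp

lemma star_diff: "(x - y)\<^sup>\<star> = (x::'a::cstar_algebra_1)\<^sup>\<star> - y\<^sup>\<star>"
  using star_add[of x "- y"] by simp

lemma star_one [simp]: "(1::'a::cstar_algebra_1)\<^sup>\<star> = 1"
  by (metis mult.left_neutral star_mult star_star)

lemma star_sum: "(\<Sum>i\<in>I. f i)\<^sup>\<star> = (\<Sum>i\<in>I. (f i :: 'a::cstar_algebra_1)\<^sup>\<star>)"
  by (induction I rule: infinite_finite_induct) (simp_all add: star_add)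

lemma star_power: "(x ^ n)\<^sup>\<star> = (x::'a::cstar_algebra_1)\<^sup>\<star> ^ n"
  by (induction n) (simp_all add: star_mult power_commutes)

lemma norm_star [simp]: "norm (x\<^sup>\<star>) = norm (x::'a::cstar_algebra_1)"
proof -
  have le: "norm y \<le> norm (y\<^sup>\<star>)" for y :: 'a
  proof (cases "y = 0")
    case False
    have "norm y * norm y \<le> norm (y\<^sup>\<star>) * norm y"
      using norm_mult_ineq[of "y\<^sup>\<star>" y] by (simp add: cstar_identity power2_eq_square)
    with False show ?thesis by simp
  qed simp
  from le[of x] le[of "x\<^sup>\<star>"] show ?thesis by (simp add: star_star)
qed

lemma bounded_linear_star: "bounded_linear (star :: 'a::cstar_algebra_1 \<Rightarrow> 'a)"
  by (rule bounded_linear_intro[where K = 1]) (simp_all add: star_add star_scaleR)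

text \<open>
  The zero algebra satisfies the axioms, so the norm of the unit is only bounded by 1.
\<close>

lemma norm_one_le: "norm (1::'a::cstar_algebra_1) \<le> 1"
proof (cases "(1::'a) = 0")
  case False
  have "norm (1::'a) * norm (1::'a) = norm (1::'a)"
    using cstar_identity[of "1::'a"] by (simp add: power2_eq_square)
  with False show ?thesis by simp
qed simp

lemma norm_power_le: "norm (x ^ n) \<le> norm (x::'a::cstar_algebra_1) ^ n"
proof (induction n)
  case (Suc n)
  have "norm (x ^ Suc n) \<le> norm x * norm (x ^ n)" by (simp add: norm_mult_ineq)
  also have "\<dots> \<le> norm x * norm x ^ n" using Suc by (intro mult_left_mono) auto
  finally show ?case by simp
qed (simp add: norm_one_le)

lemma norm_scaleR_one_le: "norm (r *\<^sub>R (1::'a::cstar_algebra_1)) \<le> \<bar>r\<bar>"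
  using mult_left_mono[OF norm_one_le[where 'a='a], of "\<bar>r\<bar>"] by simp

lemma self_adjoint_norm_square:
  "(x::'a::cstar_algebra_1)\<^sup>\<star> = x \<Longrightarrow> norm (x * x) = (norm x)\<^sup>2"
  using cstar_identity[of x] by simp

lemma self_adjoint_square_eq_0:
  "(x::'a::cstar_algebra_1)\<^sup>\<star> = x \<Longrightarrow> x * x = 0 \<Longrightarrow> x = 0"
  using self_adjoint_norm_square[of x] by simp


section \<open>Invertible elements and the spectrum\<close>

definition invertible :: "'a::monoid_mult \<Rightarrow> bool"
  where "invertible x \<longleftrightarrow> (\<exists>y. x * y = 1 \<and> y * x = 1)"

lemma invertible_mult: "invertible x \<Longrightarrow> invertible y \<Longrightarrow> invertible (x * y)"
proof -
  assume "invertible x" "invertible y"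
  then obtain x' y' where *: "x * x' = 1" "x' * x = 1" "y * y' = 1" "y' * y = 1"
    unfolding invertible_def by blast
  have "(x * y) * (y' * x') = x * (y * y') * x'" "(y' * x') * (x * y) = y' * (x' * x) * y"
    by (simp_all only: mult.assoc)
  with * have "(x * y) * (y' * x') = 1" "(y' * x') * (x * y) = 1" by simp_all
  then show ?thesis unfolding invertible_def by blast
qed

lemma invertible_scaleC:
  assumes "c \<noteq> 0" "invertible (x::'a::cstar_algebra_1)" shows "invertible (c *\<^sub>C x)"
proof -
  obtain y where "x * y = 1" "y * x = 1" using assms(2) unfolding invertible_def by blast
  with assms(1) have "(c *\<^sub>C x) * ((1 / c) *\<^sub>C y) = 1" "((1 / c) *\<^sub>C y) * (c *\<^sub>C x) = 1"
    by (simp_all add: mult_scaleC_left mult_scaleC_right scaleC_scaleC)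
  then show ?thesis unfolding invertible_def by blast
qed

lemma invertible_scaleR:
  "r \<noteq> 0 \<Longrightarrow> invertible (x::'a::cstar_algebra_1) \<Longrightarrow> invertible (r *\<^sub>R x)"
  by (simp add: scaleR_scaleC invertible_scaleC)

lemma invertible_minus: "invertible (x::'a::cstar_algebra_1) \<Longrightarrow> invertible (- x)"
  using invertible_scaleR[of "-1" x] by simp

lemma spectrum_iff: "c \<in> spectrum a \<longleftrightarrow> \<not> invertible (c *\<^sub>C 1 - a)"
  by (simp add: spectrum_def invertible_def)

text \<open>
  The inverse is the Neumann series.
\<close>

lemma invertible_one_minus:
  assumes "norm (x::'a::cstar_algebra_1) < 1" shows "invertible (1 - x)"
proof -
  have sm: "summable (\<lambda>n. x ^ n)"
    by (rule summable_comparison_test'[where N = 0 and g = "\<lambda>n. norm x ^ n"])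
      (use assms norm_power_le in \<open>auto intro!: summable_geometric\<close>)
  let ?s = "\<Sum>n. x ^ n"
  have "(\<Sum>n. x ^ Suc n) = ?s - 1"
    using suminf_split_head[OF sm] by simp
  moreover have "(\<Sum>n. x ^ Suc n) = x * ?s"
    using suminf_mult[OF sm, of x] by simp
  moreover have "(\<Sum>n. x ^ Suc n) = ?s * x"
    using suminf_mult2[OF sm, of x] by (simp add: power_commutes)
  ultimately have "?s - x * ?s = 1" "?s - ?s * x = 1"
    by (metis diff_diff_eq2 add_diff_cancel_left')+
  then have "(1 - x) * ?s = 1" "?s * (1 - x) = 1"
    by (simp_all add: left_diff_distrib right_diff_distrib)
  then show ?thesis unfolding invertible_def by blast
qed

lemma invertible_add_scaleC_one:
  assumes "norm (x::'a::cstar_algebra_1) < cmod c" shows "invertible (x + c *\<^sub>C 1)"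
proof -
  have c: "c \<noteq> 0" using assms by auto
  have "norm ((- 1 / c) *\<^sub>C x) < 1"
    using assms c by (simp add: norm_scaleC norm_divide divide_simps)
  then have "invertible (c *\<^sub>C (1 - (- 1 / c) *\<^sub>C x))"
    using invertible_one_minus invertible_scaleC c by blast
  moreover have "c *\<^sub>C (1 - (- 1 / c) *\<^sub>C x) = x + c *\<^sub>C 1"
    using c by (simp add: scaleC_add_right scaleC_scaleC)
  ultimately show ?thesis by simp
qed

text \<open>
  This says that the spectrum of a self-adjoint element is real. After moving the real part of \<open>c\<close>
  into \<open>a\<close>, it suffices to invert \<open>b + \<i> \<beta>\<close> with \<open>b\<close> self-adjoint and \<open>\<beta> \<noteq> 0\<close>. Split
  \<open>\<beta> = t + (\<beta> - t)\<close>: the C*-identity gives \<open>\<parallel>b + \<i> t\<parallel>\<^sup>2 \<le> \<parallel>b\<parallel>\<^sup>2 + t\<^sup>2\<close>, which is below \<open>(\<beta> - t)\<^sup>2\<close>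
  once \<open>t\<close> is large and of sign opposite to \<open>\<beta>\<close>.
\<close>

lemma self_adjoint_invertible_nonreal:
  assumes a: "(a::'a::cstar_algebra_1)\<^sup>\<star> = a" and c: "Im c \<noteq> 0"
  shows "invertible (a + c *\<^sub>C 1)"
proof -
  define b where "b = a + Re c *\<^sub>R 1"
  define \<beta> where "\<beta> = Im c"
  \<comment> \<open>This makes the cross term \<open>- 2 \<beta> t\<close> of \<open>(\<beta> - t)\<^sup>2\<close> equal to \<open>2 \<parallel>b\<parallel>\<^sup>2\<close>.\<close>
  define t where "t = - (norm b)\<^sup>2 / \<beta>"
  have b: "b\<^sup>\<star> = b" by (simp add: b_def star_add star_scaleR a)
  have \<beta>: "\<beta> \<noteq> 0" using c by (simp add: \<beta>_def)
  let ?y = "b + (\<i> * t) *\<^sub>C 1"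
  have it: "(\<i> * t) * (\<i> * t) = - (complex_of_real t * complex_of_real t)"
    by (simp add: complex_eq_iff)
  have "?y\<^sup>\<star> * ?y = b * b + (t\<^sup>2) *\<^sub>R 1"
    using it by (simp add: star_add b star_scaleC distrib_left distrib_right mult_scaleC_left
        mult_scaleC_right scaleC_scaleC scaleR_scaleC power2_eq_square left_diff_distrib
        scaleC_diff_right)
  then have "(norm ?y)\<^sup>2 \<le> norm (b * b) + t\<^sup>2"
    using norm_triangle_ineq[of "b * b" "(t\<^sup>2) *\<^sub>R 1"] norm_scaleR_one_le[of "t\<^sup>2", where 'a='a]
    by (simp add: cstar_identity[symmetric])
  also have "\<dots> \<le> (norm b)\<^sup>2 + t\<^sup>2" by (simp add: self_adjoint_norm_square b)
  also have "\<dots> < (\<beta> - t)\<^sup>2"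
  proof -
    have "(\<beta> - t)\<^sup>2 = \<beta>\<^sup>2 + 2 * (norm b)\<^sup>2 + t\<^sup>2"
      using \<beta> by (simp add: power2_sum t_def)
    then show ?thesis using \<beta> by (simp add: add_nonneg_pos)
  qed
  finally have "norm ?y < \<bar>\<beta> - t\<bar>" by (metis power2_abs power_less_imp_less_base abs_ge_zero)
  then have "norm ?y < cmod (\<i> * (\<beta> - t))" by (simp add: norm_mult flip: of_real_diff)
  then have "invertible (?y + (\<i> * (\<beta> - t)) *\<^sub>C 1)" by (rule invertible_add_scaleC_one)
  moreover have "?y + (\<i> * (\<beta> - t)) *\<^sub>C 1 = a + c *\<^sub>C 1"
  proof -
    have "c = Re c + (\<i> * t + \<i> * (\<beta> - t))"
      by (simp add: \<beta>_def complex_eq_iff)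
    then show ?thesis unfolding b_def scaleR_scaleC
      by (metis (no_types, lifting) add.assoc scaleC_add_left)
  qed
  ultimately show ?thesis by simp
qed

text \<open>
  Since the spectrum of a self-adjoint element is real, only negative real numbers have to be
  excluded from it.
\<close>

lemma positive_cone_iff:
  "p \<in> positive_cone \<longleftrightarrow> p\<^sup>\<star> = p \<and> (\<forall>r>0. invertible (p + r *\<^sub>R 1))" (is "?L \<longleftrightarrow> ?R")
proof
  assume L: ?L
  then have sa: "p\<^sup>\<star> = p" by (simp add: positive_cone_def self_adjoint_part_def)
  have "invertible (p + r *\<^sub>R 1)" if r: "r > 0" for r
  proof (rule ccontr)
    assume n: "\<not> ?thesis"
    have "- (complex_of_real (- r) *\<^sub>C 1 - p) = p + r *\<^sub>R 1"
      by (simp add: scaleR_scaleC)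
    with n have "complex_of_real (- r) \<in> spectrum p"
      unfolding spectrum_iff using invertible_minus by metis
    with L have "complex_of_real (- r) \<in> complex_of_real ` {0..}"
      by (auto simp: positive_cone_def)
    with r show False by (force simp: complex_eq_iff)
  qed
  with sa show ?R by blast
next
  assume R: ?R
  have "c \<in> complex_of_real ` {0..}" if c: "c \<in> spectrum p" for c
  proof -
    have eq: "- (p + (- c) *\<^sub>C 1) = c *\<^sub>C 1 - p" by simp
    have ni: "\<not> invertible (p + (- c) *\<^sub>C 1)"
      using c invertible_minus unfolding spectrum_iff eq[symmetric] by blast
    then have im: "Im c = 0" using self_adjoint_invertible_nonreal[of p "- c"] R by auto
    then have "- c = complex_of_real (- Re c)" by (simp add: complex_eq_iff)
    then have "\<not> invertible (p + (- Re c) *\<^sub>R 1)" using ni by (simp add: scaleR_scaleC)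
    with R have "Re c \<ge> 0" by (meson neg_0_less_iff_less not_le)
    with im show ?thesis by (intro image_eqI[of _ _ "Re c"]) (auto simp: complex_eq_iff)
  qed
  with R show ?L by (auto simp: positive_cone_def self_adjoint_part_def)
qed

lemma positive_cone_star: "p \<in> positive_cone \<Longrightarrow> p\<^sup>\<star> = p"
  by (simp add: positive_cone_iff)

text \<open>
  For \<open>r > 0\<close>, \<open>s\<^sup>2 + r = (s + \<i> \<surd>r) (s - \<i> \<surd>r)\<close>, and both factors are invertible because the spectrum
  of \<open>s\<close> is real.
\<close>

lemma square_positive:
  assumes s: "(s::'a::cstar_algebra_1)\<^sup>\<star> = s" shows "s * s \<in> positive_cone"
  unfolding positive_cone_iff
proof (intro conjI allI impI)
  show "(s * s)\<^sup>\<star> = s * s" by (simp add: star_mult s)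
  fix r :: real assume r: "r > 0"
  let ?c = "\<i> * sqrt r"
  have "invertible ((s + ?c *\<^sub>C 1) * (s + (- ?c) *\<^sub>C 1))"
    using r by (intro invertible_mult self_adjoint_invertible_nonreal s) auto
  moreover have "(s + ?c *\<^sub>C 1) * (s + (- ?c) *\<^sub>C 1) = s * s - (?c * ?c) *\<^sub>C 1"
    by (simp add: distrib_left distrib_right mult_scaleC_left
        mult_scaleC_right scaleC_scaleC right_diff_distrib scaleC_add_right)
  moreover have "?c * ?c = - (complex_of_real (sqrt r) * complex_of_real (sqrt r))"
    by (simp add: complex_eq_iff)
  then have "?c * ?c = - complex_of_real r"
    using r by (simp only: of_real_mult[symmetric] real_sqrt_mult_self abs_of_pos)
  ultimately show "invertible (s * s + r *\<^sub>R 1)" by (simp add: scaleR_scaleC)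
qed

section \<open>Square roots\<close>

text \<open>
  These are the Taylor coefficients of \<open>\<surd>(1 - y)\<close> at \<open>0\<close>. In terms of rising factorials, their signs,
  partial sums and convolution squares are all immediate.
\<close>

definition sqrt_coeff :: "nat \<Rightarrow> real"
  where "sqrt_coeff n = pochhammer (- 1 / 2) n / fact n"

lemma sqrt_coeff_0 [simp]: "sqrt_coeff 0 = 1"
  by (simp add: sqrt_coeff_def)

lemma sqrt_coeff_Suc_nonpos: "sqrt_coeff (Suc n) \<le> 0"
proof -
  have "0 \<le> pochhammer (1 / 2 :: real) n" by (rule pochhammer_nonneg) simp
  then show ?thesis by (simp add: sqrt_coeff_def pochhammer_rec divide_simps)
qed

lemma sum_sqrt_coeff: "(\<Sum>k\<le>n. sqrt_coeff k) = pochhammer (1 / 2) n / fact n"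
proof (induction n)
  case (Suc n)
  have m: "pochhammer (- 1 / 2 :: real) (Suc n) = - 1 / 2 * pochhammer (1 / 2) n"
    by (simp add: pochhammer_rec)
  have p: "pochhammer (1 / 2 :: real) (Suc n) = (1 / 2 + n) * pochhammer (1 / 2) n"
    by (simp add: pochhammer_Suc)
  have "(\<Sum>k\<le>Suc n. sqrt_coeff k) = pochhammer (1 / 2) n / fact n + sqrt_coeff (Suc n)"
    using Suc by simp
  also have "\<dots> = pochhammer (1 / 2) (Suc n) / fact (Suc n)"
    unfolding sqrt_coeff_def m p by (simp add: divide_simps) (simp add: algebra_simps)
  finally show ?case .
qed simp

text \<open>
  All coefficients after the first are non-positive, while the partial sums stay non-negative.
\<close>

lemma sum_abs_sqrt_coeff_le: "(\<Sum>k<n. \<bar>sqrt_coeff (Suc k)\<bar>) \<le> 1"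
proof -
  have "(\<Sum>k\<le>n. sqrt_coeff k) = 1 + (\<Sum>k<n. sqrt_coeff (Suc k))"
    by (simp add: sum.atMost_shift)
  moreover have "(\<Sum>k\<le>n. sqrt_coeff k) \<ge> 0"
    unfolding sum_sqrt_coeff by (intro divide_nonneg_nonneg pochhammer_nonneg) auto
  moreover have "(\<Sum>k<n. \<bar>sqrt_coeff (Suc k)\<bar>) = - (\<Sum>k<n. sqrt_coeff (Suc k))"
    using sqrt_coeff_Suc_nonpos by (simp add: sum_negf[symmetric])
  ultimately show ?thesis by simp
qed

lemma summable_abs_sqrt_coeff_Suc: "summable (\<lambda>n. \<bar>sqrt_coeff (Suc n)\<bar>)"
  by (rule summableI_nonneg_bounded[where x = 1]) (auto simp: sum_abs_sqrt_coeff_le)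

text \<open>
  The coefficients of \<open>\<surd>(1 - y) \<cdot> \<surd>(1 - y) = 1 - y\<close>; by the Vandermonde identity for rising
  factorials they are those of the exponent \<open>1/2 + 1/2 = 1\<close>.
\<close>

lemma sqrt_coeff_convolution:
  "(\<Sum>k\<le>n. sqrt_coeff k * sqrt_coeff (n - k)) = (if n = 0 then 1 else if n = 1 then - 1 else 0)"
proof -
  have "(\<Sum>k\<le>n. sqrt_coeff k * sqrt_coeff (n - k)) = pochhammer (- 1) n / fact n"
  proof -
    have "pochhammer (- 1 / 2 + - 1 / 2 :: real) n / fact n =
        (\<Sum>k\<le>n. of_nat (n choose k) * pochhammer (- 1 / 2) k * pochhammer (- 1 / 2) (n - k)) / fact n"
      by (simp only: pochhammer_binomial_sum)
    also have "\<dots> = (\<Sum>k\<le>n. sqrt_coeff k * sqrt_coeff (n - k))"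
      unfolding sum_divide_distrib
      by (intro sum.cong refl) (simp add: sqrt_coeff_def binomial_fact field_simps)
    finally show ?thesis by simp
  qed
  moreover have "pochhammer (- 1 :: real) n = 0" if "n \<ge> 2"
    using that pochhammer_of_nat_eq_0_iff[of 1 n, where 'a=real] by simp
  moreover have "n = 0 \<or> n = 1 \<or> n \<ge> 2" by linarith
  ultimately show ?thesis by auto
qed

text \<open>
  The binomial series converges absolutely on the whole closed unit ball, including its boundary.
  Its limit commutes with everything that commutes with \<open>y\<close>, being a limit of polynomials in \<open>y\<close>.
  The bound on \<open>1 - s\<close> later shows that the root is itself positive.
\<close>

lemma sqrt_one_minus:
  fixes y :: "'a::cstar_algebra_1"
  assumes y: "norm y \<le> 1"
  obtains s where "s * s = 1 - y" "\<And>x. x * y = y * x \<Longrightarrow> x * s = s * x"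
    "y\<^sup>\<star> = y \<Longrightarrow> s\<^sup>\<star> = s" "norm (1 - s) \<le> 1"
proof
  define f where "f n = sqrt_coeff n *\<^sub>R y ^ n" for n
  define s where "s = (\<Sum>n. f n)"
  have fle: "norm (f n) \<le> \<bar>sqrt_coeff n\<bar>" for n
  proof -
    have "norm (y ^ n) \<le> 1" using norm_power_le[of y n] y
      by (meson norm_ge_zero order_trans power_le_one)
    then show ?thesis by (simp add: f_def mult_left_le)
  qed
  have smS: "summable (\<lambda>n. norm (f (Suc n)))"
    by (rule summable_comparison_test'[OF summable_abs_sqrt_coeff_Suc, where N = 0])
      (simp add: fle)
  then have smn: "summable (\<lambda>n. norm (f n))" by (rule iffD1[OF summable_Suc_iff])
  then have sm: "summable f" by (rule summable_norm_cancel)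
  show "s * s = 1 - y"
  proof -
    have "(\<lambda>n. \<Sum>k\<le>n. f k * f (n - k)) sums (s * s)"
      unfolding s_def by (rule Cauchy_product_sums[OF smn smn])
    moreover have "(\<Sum>k\<le>n. f k * f (n - k)) = (if n = 0 then 1 else if n = 1 then - y else 0)" for n
    proof -
      have "(\<Sum>k\<le>n. f k * f (n - k)) = (\<Sum>k\<le>n. (sqrt_coeff k * sqrt_coeff (n - k)) *\<^sub>R y ^ n)"
        by (intro sum.cong refl) (simp add: f_def power_add[symmetric])
      also have "\<dots> = (\<Sum>k\<le>n. sqrt_coeff k * sqrt_coeff (n - k)) *\<^sub>R y ^ n"
        by (simp only: scaleR_sum_left)
      finally show ?thesis by (simp add: sqrt_coeff_convolution)
    qed
    ultimately have "(\<lambda>n. if n = 0 then 1 else if n = 1 then - y else 0) sums (s * s)" by simp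
    moreover have "(\<lambda>n::nat. if n = 0 then 1 else if n = 1 then - y else 0) sums
        (\<Sum>n\<in>{0,1::nat}. if n = 0 then 1 else if n = 1 then - y else 0)"
      by (rule sums_finite) auto
    ultimately have "s * s = (\<Sum>n\<in>{0,1::nat}. if n = 0 then 1 else if n = 1 then - y else 0)"
      using sums_unique2 by blast
    then show ?thesis by simp
  qed
  show "x * s = s * x" if "x * y = y * x" for x
  proof -
    have "x * f n = f n * x" for n
      using power_commuting_commutes[OF that[symmetric], of n] by (simp add: f_def)
    then show ?thesis
      unfolding s_def using suminf_mult[OF sm, of x] suminf_mult2[OF sm, of x] by simp
  qed
  show "s\<^sup>\<star> = s" if "y\<^sup>\<star> = y"
    unfolding s_def using bounded_linear.suminf[OF bounded_linear_star sm]
    by (simp add: f_def [abs_def] star_scaleR star_power that)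
  show "norm (1 - s) \<le> 1"
  proof -
    have "1 - s = - (\<Sum>n. f (Suc n))"
      using suminf_split_head[OF sm] f_def[of 0] by (simp add: s_def)
    also have "norm \<dots> \<le> (\<Sum>n. norm (f (Suc n)))"
      using summable_norm[OF smS] by simp
    also have "\<dots> \<le> (\<Sum>n. \<bar>sqrt_coeff (Suc n)\<bar>)"
      by (intro suminf_le fle smS summable_abs_sqrt_coeff_Suc)
    also have "\<dots> \<le> 1"
      by (intro suminf_le_const summable_abs_sqrt_coeff_Suc sum_abs_sqrt_coeff_le)
    finally show ?thesis .
  qed
qed


section \<open>The positive cone\<close>

lemma inverse_commute:
  fixes q q' x :: "'a::monoid_mult"
  assumes "q * q' = 1" "q' * q = 1" "x * q = q * x"
  shows "x * q' = q' * x"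
proof -
  have "q' * x = q' * (x * q) * q'" by (simp add: mult.assoc assms(1))
  also have "\<dots> = (q' * q) * x * q'" unfolding assms(3) by (simp only: mult.assoc)
  finally show ?thesis by (simp add: assms(2))
qed

lemma inverse_self_adjoint:
  fixes q q' :: "'a::cstar_algebra_1"
  assumes "q * q' = 1" "q\<^sup>\<star> = q"
  shows "q'\<^sup>\<star> = q'"
proof -
  have "q'\<^sup>\<star> * q = 1" using arg_cong[OF assms(1), of star] by (simp add: star_mult assms(2))
  moreover have "q'\<^sup>\<star> = (q'\<^sup>\<star> * q) * q'" by (simp add: mult.assoc assms(1))
  ultimately show ?thesis by (metis mult.left_neutral)
qed

text \<open>
  A substitute for the equality of norm and spectral radius: applied to \<open>b\<close> of norm 1, it says that
  \<open>1\<close> or \<open>- 1\<close> lies in the spectrum of \<open>b\<close>.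

  Put \<open>q = 1 - b\<^sup>2\<close>. If \<open>q\<close> is invertible and \<open>K\<close> bounds the norm of its inverse, then \<open>q = s\<^sup>2\<close> and
  \<open>1 - q\<^sup>-\<^sup>1 / K = v\<^sup>2\<close> have self-adjoint roots that commute with each other and with \<open>b\<close>. Multiplying
  the second equation by the first gives \<open>q - 1 / K = (s v)\<^sup>2\<close>, that is
  \<open>b\<^sup>2 + (s v)\<^sup>2 = 1 - 1 / K\<close>. So \<open>b\<close> is the real part of \<open>b + \<i> s v\<close>, an element of norm less than 1.
\<close>

lemma self_adjoint_norm_less_one:
  assumes b: "(b::'a::cstar_algebra_1)\<^sup>\<star> = b" and nb: "norm b \<le> 1"
    and inv: "invertible (1 - b * b)"
  shows "norm b < 1"
proof -
  define q where "q = 1 - b * b"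
  obtain q' where q': "q * q' = 1" "q' * q = 1"
    using inv unfolding invertible_def q_def by blast
  have q_sa: "q\<^sup>\<star> = q" by (simp add: q_def star_diff star_mult b)
  have q'_sa: "q'\<^sup>\<star> = q'" by (rule inverse_self_adjoint[OF q'(1) q_sa])
  \<comment> \<open>Adding 1 keeps \<open>1 - 1 / K\<close> between 0 and 1, also in the zero algebra.\<close>
  define K where "K = norm q' + 1"
  have K: "K > 0" "K \<ge> 1" "norm q' \<le> K" by (simp_all add: K_def add_nonneg_pos)
  have "norm (b * b) \<le> 1"
    using nb by (simp add: self_adjoint_norm_square b power_le_one)
  then obtain s where s: "s * s = 1 - b * b" "\<And>x. x * (b * b) = (b * b) * x \<Longrightarrow> x * s = s * x"
      "(b * b)\<^sup>\<star> = b * b \<Longrightarrow> s\<^sup>\<star> = s" by (rule sqrt_one_minus) blast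
  have "norm ((1 / K) *\<^sub>R q') \<le> 1" using K by simp
  then obtain v where v: "v * v = 1 - (1 / K) *\<^sub>R q'"
      "\<And>x. x * ((1 / K) *\<^sub>R q') = ((1 / K) *\<^sub>R q') * x \<Longrightarrow> x * v = v * x"
      "((1 / K) *\<^sub>R q')\<^sup>\<star> = (1 / K) *\<^sub>R q' \<Longrightarrow> v\<^sup>\<star> = v" by (rule sqrt_one_minus) blast
  have s_sa: "s\<^sup>\<star> = s" by (rule s(3)) (simp add: star_mult b)
  have v_sa: "v\<^sup>\<star> = v" by (rule v(3)) (simp add: star_scaleR q'_sa)
  have bs: "b * s = s * b" by (rule s(2)) (simp add: mult.assoc)
  have qv: "x * v = v * x" if "x * q = q * x" for x
    using inverse_commute[OF q' that] by (intro v(2)) simp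
  have bv: "b * v = v * b"
    by (rule qv) (simp add: q_def left_diff_distrib right_diff_distrib mult.assoc)
  have sv: "s * v = v * s"
    by (rule qv) (simp add: q_def flip: s(1) mult.assoc)
  define e where "e = s * v"
  have e_sa: "e\<^sup>\<star> = e" by (simp add: e_def star_mult s_sa v_sa sv)
  have be: "b * e = e * b" unfolding e_def by (metis bs bv mult.assoc)
  have "e * e = (s * s) * (v * v)" unfolding e_def by (metis sv mult.assoc)
  then have ee: "e * e = 1 - b * b - (1 / K) *\<^sub>R 1"
    using q' by (simp add: v(1) s(1) right_diff_distrib flip: q_def)
  let ?u = "b + \<i> *\<^sub>C e"
  have "?u\<^sup>\<star> * ?u = b * b + e * e"
    by (simp add: star_add b star_scaleC e_sa distrib_left distrib_right mult_scaleC_left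
        mult_scaleC_right scaleC_scaleC scaleC_diff_right be left_diff_distrib)
  also have "\<dots> = (1 - 1 / K) *\<^sub>R 1" by (simp add: ee scaleR_left_diff_distrib)
  finally have "(norm ?u)\<^sup>2 = norm ((1 - 1 / K) *\<^sub>R (1::'a))" by (simp only: flip: cstar_identity)
  also have "\<dots> \<le> \<bar>1 - 1 / K\<bar>" by (rule norm_scaleR_one_le)
  also have "\<dots> < 1" using K by (simp add: abs_if)
  finally have u: "norm ?u < 1" by (simp add: power2_less_1_iff)
  have "2 *\<^sub>R b = ?u + ?u\<^sup>\<star>" by (simp add: star_add b star_scaleC e_sa scaleR_2)
  then have "2 * norm b \<le> norm ?u + norm ?u"
    using norm_triangle_ineq[of ?u "?u\<^sup>\<star>"] by (metis norm_scaleR norm_star abs_numeral)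
  with u show ?thesis by simp
qed

text \<open>
  Suppose \<open>m = \<parallel>1 - e p\<parallel> > 1\<close> and let \<open>b = (1 - e p) / m\<close>, of norm 1. Then \<open>m (1 - b) = (m - 1) + e p\<close>
  is invertible because \<open>p\<close> is positive, and \<open>m (1 + b) = (m + 1) - e p\<close> is invertible because
  \<open>e p\<close> has norm at most 1. So \<open>1 - b\<^sup>2\<close> is invertible, which contradicts \<open>\<parallel>b\<parallel> = 1\<close>.
\<close>

lemma positive_cone_norm:
  assumes p: "p \<in> positive_cone" and e: "e \<ge> 0" "e * norm p \<le> 1"
  shows "norm (1 - e *\<^sub>R p) \<le> 1"
proof (rule ccontr)
  define m where "m = norm (1 - e *\<^sub>R p)"
  assume "\<not> norm (1 - e *\<^sub>R p) \<le> 1"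
  then have m: "m > 1" by (simp add: m_def)
  have e0: "e > 0"
    using e(1) m norm_one_le[where 'a='a] by (cases "e = 0") (auto simp: m_def)
  define b where "b = (1 / m) *\<^sub>R (1 - e *\<^sub>R p)"
  have b: "b\<^sup>\<star> = b" by (simp add: b_def star_scaleR star_diff positive_cone_star[OF p])
  have nb: "norm b = 1" using m by (simp add: b_def flip: m_def)
  have "invertible ((e / m) *\<^sub>R (p + ((m - 1) / e) *\<^sub>R 1))"
    using p e0 m by (intro invertible_scaleR) (auto simp: positive_cone_iff)
  moreover have "(e / m) *\<^sub>R (p + ((m - 1) / e) *\<^sub>R 1) = 1 - b"
    using e0 m by (simp add: b_def scaleR_add_right scaleR_diff_right scaleR_left_diff_distrib diff_divide_distrib)
  ultimately have 1: "invertible (1 - b)" by simp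
  have "norm p < (m + 1) / e"
    using e0 e(2) m by (simp add: field_simps)
  moreover have "cmod (complex_of_real (- ((m + 1) / e))) = (m + 1) / e"
    using m e0 by (simp only: norm_of_real abs_minus_cancel) (rule abs_of_pos, simp)
  ultimately have "invertible (p + complex_of_real (- ((m + 1) / e)) *\<^sub>C 1)"
    by (intro invertible_add_scaleC_one) (simp only:)
  then have "invertible ((- e / m) *\<^sub>R (p + (- ((m + 1) / e)) *\<^sub>R 1))"
    using e0 m by (intro invertible_scaleR) (auto simp: scaleR_scaleC)
  moreover have "(- e / m) *\<^sub>R (p + (- ((m + 1) / e)) *\<^sub>R 1) = 1 + b"
  proof -
    have k: "(e / m) * ((m + 1) / e) = 1 + 1 / m" using e0 m by (simp add: field_simps)
    have "(- e / m) *\<^sub>R (p + (- ((m + 1) / e)) *\<^sub>R 1) =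
        ((e / m) * ((m + 1) / e)) *\<^sub>R 1 - (e / m) *\<^sub>R p"
      using e0 by (simp add: scaleR_add_right scaleR_diff_right)
    then show ?thesis unfolding k by (simp add: b_def scaleR_diff_right scaleR_left_distrib)
  qed
  ultimately have 2: "invertible (1 + b)" by simp
  have "(1 - b) * (1 + b) = 1 - b * b" by (simp add: left_diff_distrib distrib_left)
  then have "norm b < 1"
    using self_adjoint_norm_less_one[OF b] nb invertible_mult[OF 1 2] by simp
  with nb show False by simp
qed

text \<open>
  \<open>e (p + r) = (1 + e r) - (1 - e p)\<close> is invertible by the Neumann series.
\<close>

lemma positive_coneI_norm:
  assumes p: "(p::'a::cstar_algebra_1)\<^sup>\<star> = p" and e: "e > 0" "norm (1 - e *\<^sub>R p) \<le> 1"
  shows "p \<in> positive_cone"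
  unfolding positive_cone_iff
proof (intro conjI allI impI p)
  fix r :: real assume r: "r > 0"
  have "e * r > 0" using e(1) r by simp
  then have "norm (1 - e *\<^sub>R p) < cmod (complex_of_real (- (1 + e * r)))"
    using e(2) by (simp only: norm_of_real)
  then have "invertible ((1 - e *\<^sub>R p) + (- (1 + e * r)) *\<^sub>R 1)"
    unfolding scaleR_scaleC by (rule invertible_add_scaleC_one)
  then have "invertible ((- 1 / e) *\<^sub>R ((1 - e *\<^sub>R p) + (- (1 + e * r)) *\<^sub>R 1))"
    using e(1) by (intro invertible_scaleR) auto
  moreover have "(- 1 / e) *\<^sub>R ((1 - e *\<^sub>R p) + (- (1 + e * r)) *\<^sub>R 1) = p + r *\<^sub>R 1"
    using e(1) by (simp add: scaleR_add_right scaleR_diff_right scaleR_left_diff_distrib scaleR_left_distrib)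
  ultimately show "invertible (p + r *\<^sub>R 1)" by simp
qed

text \<open>
  The norm criterion is convex in \<open>p\<close>, once a common \<open>e\<close> is chosen for both summands.
\<close>

lemma positive_cone_add:
  assumes p: "p \<in> positive_cone" and q: "q \<in> positive_cone"
  shows "p + q \<in> positive_cone"
proof -
  define e where "e = 1 / (norm p + norm q + 1)"
  have d: "norm p + norm q + 1 > 0" by (simp add: add_nonneg_pos)
  have e: "e > 0" "e * norm p \<le> 1" "e * norm q \<le> 1"
    using d by (simp_all add: e_def divide_simps)
  have "1 - (e / 2) *\<^sub>R (p + q) = (1 / 2) *\<^sub>R ((1 - e *\<^sub>R p) + (1 - e *\<^sub>R q))"
    by (simp add: scaleR_add_right scaleR_diff_right flip: scaleR_left_distrib)
  also have "norm \<dots> \<le> 1"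
    using norm_triangle_ineq[of "1 - e *\<^sub>R p" "1 - e *\<^sub>R q"]
      positive_cone_norm[OF p _ e(2)] positive_cone_norm[OF q _ e(3)] e(1) by simp
  finally show ?thesis
    using e(1) by (intro positive_coneI_norm[where e = "e / 2"])
      (simp_all add: star_add positive_cone_star p q)
qed

lemma positive_cone_zero: "0 \<in> positive_cone"
  using square_positive[of 0] by simp

lemma positive_cone_scaleR:
  assumes p: "p \<in> positive_cone" and r: "r \<ge> 0"
  shows "r *\<^sub>R p \<in> positive_cone"
proof (cases "r = 0")
  case False
  define e where "e = 1 / (norm p + 1)"
  have d: "norm p + 1 > 0" by (simp add: add_nonneg_pos)
  have e: "e > 0" "e * norm p \<le> 1" using d by (simp_all add: e_def)
  then show ?thesis
    using False r positive_cone_norm[OF p _ e(2)]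
    by (intro positive_coneI_norm[where e = "e / r"]) (simp_all add: star_scaleR positive_cone_star p)
qed (simp add: positive_cone_zero)

text \<open>
  The part of the closedness of the cone that is used below. A single \<open>e\<close> in the norm criterion
  serves all \<open>t \<le> 1\<close>, so that \<open>t\<close> may tend to \<open>0\<close>.
\<close>

lemma positive_cone_limit:
  fixes p r :: "'a::cstar_algebra_1"
  assumes "\<And>t. t > 0 \<Longrightarrow> p + t *\<^sub>R r \<in> positive_cone"
  shows "p \<in> positive_cone"
proof -
  define e where "e = 1 / (norm p + norm r + 1)"
  have d: "norm p + norm r + 1 > 0" by (simp add: add_nonneg_pos)
  have e: "e > 0" using d by (simp add: e_def)
  have *: "norm (1 - e *\<^sub>R p) \<le> 1 + t * (e * norm r)" if t: "0 < t" "t \<le> 1" for t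
  proof -
    have "norm (p + t *\<^sub>R r) \<le> norm p + norm r"
      using norm_triangle_ineq[of p "t *\<^sub>R r"] t mult_right_mono[of t 1 "norm r"] by simp
    then have "e * norm (p + t *\<^sub>R r) \<le> 1" using d by (simp add: e_def)
    then have "norm (1 - e *\<^sub>R (p + t *\<^sub>R r)) \<le> 1"
      using e by (intro positive_cone_norm assms t) auto
    moreover have "1 - e *\<^sub>R p = (1 - e *\<^sub>R (p + t *\<^sub>R r)) + (e * t) *\<^sub>R r"
      by (simp add: scaleR_add_right)
    then have "norm (1 - e *\<^sub>R p) \<le> norm (1 - e *\<^sub>R (p + t *\<^sub>R r)) + norm ((e * t) *\<^sub>R r)"
      by (metis norm_triangle_ineq)
    moreover have "norm ((e * t) *\<^sub>R r) = t * (e * norm r)" using e t by simp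
    ultimately show ?thesis by linarith
  qed
  have "((\<lambda>t. 1 + t * (e * norm r)) \<longlongrightarrow> 1 + 0 * (e * norm r)) (at_right 0)"
    by (intro tendsto_intros)
  moreover have "eventually (\<lambda>t. norm (1 - e *\<^sub>R p) \<le> 1 + t * (e * norm r)) (at_right 0)"
    unfolding eventually_at_right[OF zero_less_one] using * by (intro exI[of _ 1]) auto
  ultimately have n: "norm (1 - e *\<^sub>R p) \<le> 1"
    by (simp add: tendsto_lowerbound)
  \<comment> \<open>Self-adjointness at \<open>t = 1\<close> and \<open>t = 2\<close> determines that of \<open>p\<close> by linearity.\<close>
  have 1: "p\<^sup>\<star> + r\<^sup>\<star> = p + r" using positive_cone_star[OF assms[of 1]] by (simp add: star_add)
  have 2: "p\<^sup>\<star> + 2 *\<^sub>R r\<^sup>\<star> = p + 2 *\<^sub>R r"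
    using positive_cone_star[OF assms[of 2]] by (simp add: star_add star_scaleR)
  have "2 *\<^sub>R (p\<^sup>\<star> + r\<^sup>\<star>) - (p\<^sup>\<star> + 2 *\<^sub>R r\<^sup>\<star>) = 2 *\<^sub>R (p + r) - (p + 2 *\<^sub>R r)"
    by (simp only: 1 2)
  then have "p\<^sup>\<star> = p" by (simp add: scaleR_add_right scaleR_2)
  then show ?thesis using e n by (rule positive_coneI_norm)
qed

lemma positive_cone_sqrt:
  assumes p: "p \<in> positive_cone"
  obtains s where "s \<in> positive_cone" "s * s = p" "\<And>x. x * p = p * x \<Longrightarrow> x * s = s * x"
proof -
  define e where "e = 1 / (norm p + 1)"
  have d: "norm p + 1 > 0" by (simp add: add_nonneg_pos)
  have e: "e > 0" "e * norm p \<le> 1" using d by (simp_all add: e_def)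
  have "norm (1 - e *\<^sub>R p) \<le> 1" using positive_cone_norm[OF p _ e(2)] e(1) by simp
  then obtain s where s: "s * s = 1 - (1 - e *\<^sub>R p)"
      "\<And>x. x * (1 - e *\<^sub>R p) = (1 - e *\<^sub>R p) * x \<Longrightarrow> x * s = s * x"
      "(1 - e *\<^sub>R p)\<^sup>\<star> = 1 - e *\<^sub>R p \<Longrightarrow> s\<^sup>\<star> = s" "norm (1 - s) \<le> 1" by (rule sqrt_one_minus) blast
  have "s\<^sup>\<star> = s" by (rule s(3)) (simp add: star_diff star_scaleR positive_cone_star p)
  then have "s \<in> positive_cone" using s(4) by (intro positive_coneI_norm[where e = 1]) simp_all
  then have "(1 / sqrt e) *\<^sub>R s \<in> positive_cone" using e(1) by (intro positive_cone_scaleR) auto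
  moreover have "((1 / sqrt e) *\<^sub>R s) * ((1 / sqrt e) *\<^sub>R s) = p" using e(1) by (simp add: s(1))
  moreover have "x * ((1 / sqrt e) *\<^sub>R s) = ((1 / sqrt e) *\<^sub>R s) * x" if "x * p = p * x" for x
    using s(2)[of x] that by (simp add: left_diff_distrib right_diff_distrib)
  ultimately show ?thesis by (rule that)
qed

text \<open>
  If \<open>p\<close> were nonzero, normalizing it to norm 1 would give \<open>b\<close> with \<open>1 + b\<close> and \<open>1 - b\<close> invertible,
  which \<open>self_adjoint_norm_less_one\<close> excludes.
\<close>

lemma positive_cone_antisym:
  assumes p: "p \<in> positive_cone" and n: "- p \<in> positive_cone"
  shows "p = 0"
proof (rule ccontr)
  assume p0: "p \<noteq> 0"
  define b where "b = (1 / norm p) *\<^sub>R p"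
  have b: "b \<in> positive_cone" "- b \<in> positive_cone"
    using positive_cone_scaleR[OF p, of "1 / norm p"] positive_cone_scaleR[OF n, of "1 / norm p"]
    by (simp_all add: b_def)
  then have i: "invertible (b + 1 *\<^sub>R 1)" "invertible (- b + 1 *\<^sub>R 1)"
    unfolding positive_cone_iff by (meson zero_less_one)+
  have "(b + 1 *\<^sub>R 1) * (- b + 1 *\<^sub>R 1) = 1 - b * b"
    by (simp add: distrib_left distrib_right right_diff_distrib)
  then have "invertible (1 - b * b)" using invertible_mult[OF i] by simp
  moreover have "norm b = 1" using p0 by (simp add: b_def)
  ultimately show False using self_adjoint_norm_less_one[of b] b positive_cone_star[of b] by simp
qed

text \<open>
  The nonzero spectra of \<open>x y\<close> and \<open>y x\<close> agree: if \<open>w\<close> is the inverse of \<open>x y + r\<close>, then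
  \<open>(1 - y w x) / r\<close> is the inverse of \<open>y x + r\<close>.
\<close>

lemma invertible_mult_swap:
  fixes x y :: "'a::cstar_algebra_1"
  assumes r: "r \<noteq> 0" and inv: "invertible (x * y + r *\<^sub>R 1)"
  shows "invertible (y * x + r *\<^sub>R 1)"
proof -
  obtain w where w: "(x * y + r *\<^sub>R 1) * w = 1" "w * (x * y + r *\<^sub>R 1) = 1"
    using inv unfolding invertible_def by blast
  have 1: "x * y * w = 1 - r *\<^sub>R w" and 2: "w * (x * y) = 1 - r *\<^sub>R w"
    using w by (simp_all add: distrib_left distrib_right eq_diff_eq)
  have "(y * x + r *\<^sub>R 1) * (1 - y * w * x) = r *\<^sub>R 1 + y * x - y * (x * y * w) * x - r *\<^sub>R (y * w * x)"
    by (simp add: right_diff_distrib distrib_right mult.assoc scaleR_diff_right)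
  also have "\<dots> = r *\<^sub>R 1" unfolding 1
    by (simp add: right_diff_distrib left_diff_distrib scaleR_diff_right mult.assoc)
  finally have a: "(y * x + r *\<^sub>R 1) * ((1 / r) *\<^sub>R (1 - y * w * x)) = 1" using r by simp
  have "(1 - y * w * x) * (y * x + r *\<^sub>R 1) = r *\<^sub>R 1 + y * x - y * (w * (x * y)) * x - r *\<^sub>R (y * w * x)"
    by (simp add: left_diff_distrib distrib_left mult.assoc scaleR_diff_right)
  also have "\<dots> = r *\<^sub>R 1" unfolding 2
    by (simp add: right_diff_distrib left_diff_distrib scaleR_diff_right mult.assoc)
  finally have "((1 / r) *\<^sub>R (1 - y * w * x)) * (y * x + r *\<^sub>R 1) = 1" using r by simp
  with a show ?thesis unfolding invertible_def by blast
qed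

text \<open>
  Let \<open>h = a\<^sup>\<star> a\<close>, let \<open>k = |h|\<close> be the positive root of \<open>h\<^sup>2\<close>, and let \<open>g = k - h\<close>, twice the negative
  part of \<open>h\<close>; the aim is \<open>g = 0\<close>. From \<open>k\<^sup>2 = h\<^sup>2\<close> one gets \<open>g h = - g k\<close>. Hence \<open>c = a g\<close> satisfies
  \<open>c\<^sup>\<star> c = g h g = - g k g\<close>, which is minus the square of \<open>f = g \<surd>k\<close>. On the other hand,
  \<open>c\<^sup>\<star> c + c c\<^sup>\<star>\<close> is half of a sum of two squares of self-adjoint elements, so \<open>c c\<^sup>\<star>\<close> is positive,
  and then so is \<open>c\<^sup>\<star> c\<close>, since the two have the same spectrum away from 0. Therefore \<open>c\<^sup>\<star> c = 0\<close>,
  which forces \<open>f = 0\<close>, then \<open>g\<^sup>2 = 2 g k = 0\<close>, and \<open>h = k\<close>.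
\<close>

lemma star_mult_self_positive: "(a::'a::cstar_algebra_1)\<^sup>\<star> * a \<in> positive_cone"
proof -
  define h where "h = a\<^sup>\<star> * a"
  have h: "h\<^sup>\<star> = h" by (simp add: h_def star_mult star_star)
  obtain k where k: "k \<in> positive_cone" "k * k = h * h" "\<And>x. x * (h * h) = (h * h) * x \<Longrightarrow> x * k = k * x"
    using positive_cone_sqrt[OF square_positive[OF h]] by blast
  have hk: "h * k = k * h" by (rule k(3)) (simp add: mult.assoc)
  obtain m where m: "m \<in> positive_cone" "m * m = k" "\<And>x. x * k = k * x \<Longrightarrow> x * m = m * x"
    by (rule positive_cone_sqrt[OF k(1)]) blast
  have hm: "h * m = m * h" by (rule m(3)[OF hk])
  have km: "k * m = m * k" by (rule m(3)) simp
  define g where "g = k - h"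
  have g: "g\<^sup>\<star> = g" by (simp add: g_def star_diff h positive_cone_star[OF k(1)])
  have gm: "g * m = m * g" by (simp add: g_def left_diff_distrib right_diff_distrib hm km)
  have gh: "g * h = - (g * k)" by (simp add: g_def left_diff_distrib hk k(2))
  define f where "f = g * m"
  have f: "f\<^sup>\<star> = f" by (simp add: f_def star_mult g positive_cone_star[OF m(1)] gm)
  have gkg: "g * k * g = f * f" unfolding f_def m(2)[symmetric] by (metis gm mult.assoc)
  define c where "c = a * g"
  have "c\<^sup>\<star> * c = g * h * g" by (simp add: c_def star_mult g h_def mult.assoc)
  then have cc: "c\<^sup>\<star> * c = - (f * f)" by (simp add: gh gkg)
  have neg: "- (c\<^sup>\<star> * c) \<in> positive_cone" by (simp add: cc square_positive f)
  \<comment> \<open>\<open>x\<close> and \<open>y\<close> are twice the real part and, up to sign, twice the imaginary part of \<open>c\<close>.\<close>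
  define x where "x = c + c\<^sup>\<star>"
  define y where "y = \<i> *\<^sub>C (c - c\<^sup>\<star>)"
  have "x * x \<in> positive_cone" "y * y \<in> positive_cone"
    by (rule square_positive, simp add: x_def y_def star_add star_diff star_scaleC star_star add.commute flip: scaleC_simps(5))+
  moreover have "x * x + y * y = 2 *\<^sub>R (c\<^sup>\<star> * c) + 2 *\<^sub>R (c * c\<^sup>\<star>)"
    by (simp add: x_def y_def mult_scaleC_left mult_scaleC_right scaleC_scaleC scaleC_diff_right
        distrib_left distrib_right left_diff_distrib right_diff_distrib scaleR_2)
  ultimately have "(2 *\<^sub>R (c\<^sup>\<star> * c) + 2 *\<^sub>R (c * c\<^sup>\<star>)) + 2 *\<^sub>R (- (c\<^sup>\<star> * c)) \<in> positive_cone"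
    using neg by (metis positive_cone_add positive_cone_scaleR zero_le_numeral)
  then have "2 *\<^sub>R (c * c\<^sup>\<star>) \<in> positive_cone" by simp
  from positive_cone_scaleR[OF this, of "1 / 2"] have "c * c\<^sup>\<star> \<in> positive_cone" by simp
  then have "c\<^sup>\<star> * c \<in> positive_cone"
    unfolding positive_cone_iff using invertible_mult_swap[of _ c "c\<^sup>\<star>"]
    by (auto simp: star_mult star_star)
  then have "f * f = 0" using positive_cone_antisym neg cc by fastforce
  then have "f = 0" by (rule self_adjoint_square_eq_0[OF f])
  then have "g * k = 0" by (simp add: f_def flip: m(2) mult.assoc)
  then have "g * g = 0" using gh by (subst (2) g_def) (simp add: right_diff_distrib)
  then have "g = 0" by (rule self_adjoint_square_eq_0[OF g])
  then have "h = k" by (simp add: g_def)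
  with k(1) show ?thesis by (simp add: h_def)
qed

lemma positive_cone_conjugate:
  assumes "p \<in> positive_cone" shows "b\<^sup>\<star> * p * b \<in> positive_cone"
proof -
  obtain s where s: "s \<in> positive_cone" "s * s = p" by (rule positive_cone_sqrt[OF assms]) blast
  have "b\<^sup>\<star> * p * b = (s * b)\<^sup>\<star> * (s * b)"
    by (simp add: star_mult positive_cone_star[OF s(1)] mult.assoc flip: s(2))
  then show ?thesis by (simp add: star_mult_self_positive)
qed


section \<open>Positive matrices over the center\<close>

definition hermitian_form :: "nat \<Rightarrow> (nat \<Rightarrow> nat \<Rightarrow> 'a::cstar_algebra_1) \<Rightarrow> (nat \<Rightarrow> 'a) \<Rightarrow> 'a"
  where "hermitian_form n z b = (\<Sum>i<n. \<Sum>j<n. (b i)\<^sup>\<star> * z i j * b j)"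

lemma center_zero: "0 \<in> algebra_center"
  and center_one: "1 \<in> algebra_center"
  by (simp_all add: algebra_center_def)

lemma center_diff: "x \<in> algebra_center \<Longrightarrow> y \<in> algebra_center \<Longrightarrow> x - y \<in> algebra_center"
  by (simp add: algebra_center_def left_diff_distrib right_diff_distrib)

lemma center_minus: "x \<in> algebra_center \<Longrightarrow> - x \<in> algebra_center"
  by (simp add: algebra_center_def)

lemma center_mult:
  assumes x: "x \<in> algebra_center" and y: "y \<in> algebra_center"
  shows "x * y \<in> algebra_center"
proof -
  have "x * y * a = a * (x * y)" for a
  proof -
    have "x * y * a = x * (y * a)" by (simp only: mult.assoc)
    also have "y * a = a * y" using y by (simp add: algebra_center_def)
    also have "x * (a * y) = (x * a) * y" by (simp only: mult.assoc)
    also have "x * a = a * x" using x by (simp add: algebra_center_def)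
    finally show ?thesis by (simp only: mult.assoc)
  qed
  then show ?thesis by (simp add: algebra_center_def)
qed

lemma center_sum: "(\<And>i. i \<in> I \<Longrightarrow> f i \<in> algebra_center) \<Longrightarrow> sum f I \<in> algebra_center"
  by (simp add: algebra_center_def sum_distrib_left sum_distrib_right)

lemma center_star:
  assumes x: "x \<in> algebra_center" shows "x\<^sup>\<star> \<in> algebra_center"
proof -
  have "x\<^sup>\<star> * a = a * x\<^sup>\<star>" for a
  proof -
    have "x * a\<^sup>\<star> = a\<^sup>\<star> * x" using x by (simp add: algebra_center_def)
    from arg_cong[OF this, of star] show ?thesis by (simp add: star_mult star_star)
  qed
  then show ?thesis by (simp add: algebra_center_def)
qed

text \<open>
  One step of symmetric elimination: the entries \<open>z i j - z i n * q * z n j\<close> are the Schur complement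
  of the pivot \<open>z n n\<close>, whose inverse is \<open>q\<close>.
\<close>

lemma hermitian_form_Suc_complete_square:
  assumes herm: "\<And>i j. i < Suc n \<Longrightarrow> j < Suc n \<Longrightarrow> z j i = (z i j)\<^sup>\<star>"
    and q: "z n n * q = 1" "q * z n n = 1"
  defines "w b \<equiv> \<Sum>j<n. z n j * b j"
  shows "hermitian_form (Suc n) z b =
    hermitian_form n (\<lambda>i j. z i j - z i n * q * z n j) b + (b n + q * w b)\<^sup>\<star> * z n n * (b n + q * w b)"
proof -
  have q_sa: "q\<^sup>\<star> = q" by (rule inverse_self_adjoint[OF q(1)], rule herm[symmetric]) simp_all
  have ws: "(w b)\<^sup>\<star> = (\<Sum>i<n. (b i)\<^sup>\<star> * z i n)"
    unfolding w_def star_sum star_mult by (intro sum.cong refl) (subst herm[of _ n], simp_all add: star_star)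
  have "hermitian_form (Suc n) z b = hermitian_form n z b + (w b)\<^sup>\<star> * b n + (b n)\<^sup>\<star> * w b + (b n)\<^sup>\<star> * z n n * b n"
  proof -
    have "(w b)\<^sup>\<star> * b n = (\<Sum>i<n. (b i)\<^sup>\<star> * z i n * b n)"
      by (simp add: ws sum_distrib_right)
    moreover have "(b n)\<^sup>\<star> * w b = (\<Sum>j<n. (b n)\<^sup>\<star> * z n j * b j)"
      by (simp add: w_def sum_distrib_left mult.assoc)
    ultimately show ?thesis by (simp add: hermitian_form_def sum.distrib)
  qed
  moreover have "hermitian_form n (\<lambda>i j. z i j - z i n * q * z n j) b = hermitian_form n z b - (w b)\<^sup>\<star> * q * w b"
  proof -
    have "(w b)\<^sup>\<star> * q * w b = (\<Sum>i<n. \<Sum>j<n. (b i)\<^sup>\<star> * (z i n * q * z n j) * b j)"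
    proof -
      have "q * w b = (\<Sum>j<n. q * (z n j * b j))" by (simp add: w_def sum_distrib_left)
      then have "(w b)\<^sup>\<star> * (q * w b) = (\<Sum>i<n. (b i)\<^sup>\<star> * z i n) * (\<Sum>j<n. q * (z n j * b j))"
        by (simp only: ws)
      then show ?thesis by (simp only: sum_product mult.assoc)
    qed
    then show ?thesis
      by (simp add: hermitian_form_def left_diff_distrib right_diff_distrib sum_subtractf)
  qed
  moreover have "(b n + q * w b)\<^sup>\<star> * z n n * (b n + q * w b) =
      (b n)\<^sup>\<star> * z n n * b n + (b n)\<^sup>\<star> * (z n n * q) * w b + (w b)\<^sup>\<star> * (q * z n n) * b n
        + (w b)\<^sup>\<star> * (q * z n n) * q * w b"
    by (simp add: star_add star_mult q_sa distrib_left distrib_right mult.assoc)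
  ultimately show ?thesis by (simp add: q)
qed

text \<open>
  A central Hermitian matrix that is strictly positive on central vectors is positive everywhere, by
  induction on its size. Testing with the last basis vector shows that the pivot is at least \<open>e\<close>,
  hence invertible, with inverse in the center. A central vector \<open>d\<close> of length \<open>n\<close> extends by the
  central entry \<open>- (q * w d)\<close> to one on which the completed square vanishes; so the Schur complement
  inherits the hypothesis, with the same \<open>e\<close>. Central test
  vectors suffice because \<open>q\<close> and the entries of the matrix are central.
\<close>

lemma hermitian_form_positive_strict:
  assumes "\<And>i j. i < n \<Longrightarrow> j < n \<Longrightarrow> z i j \<in> algebra_center"
    and "\<And>i j. i < n \<Longrightarrow> j < n \<Longrightarrow> z j i = (z i j)\<^sup>\<star>"
    and e: "e > 0"
    and "\<And>d. (\<And>i. i < n \<Longrightarrow> d i \<in> algebra_center) \<Longrightarrow>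
      hermitian_form n z d - e *\<^sub>R (\<Sum>i<n. (d i)\<^sup>\<star> * d i) \<in> positive_cone"
  shows "hermitian_form n z b \<in> positive_cone"
  using assms(1,2,4)
proof (induction n arbitrary: z)
  case 0
  show ?case by (simp add: hermitian_form_def positive_cone_zero)
next
  case (Suc n)
  note cen = Suc.prems(1) and herm = Suc.prems(2) and pos = Suc.prems(3)
  \<comment> \<open>The pivot is bounded below by \<open>e\<close>, as the value of the form at the last basis vector.\<close>
  define \<delta> :: "nat \<Rightarrow> 'a" where "\<delta> i = (if i = n then 1 else 0)" for i
  have \<delta>: "\<delta> n = 1" "\<And>i. i < n \<Longrightarrow> \<delta> i = 0" by (simp_all add: \<delta>_def)
  have "hermitian_form (Suc n) z \<delta> = z n n" "(\<Sum>i<Suc n. (\<delta> i)\<^sup>\<star> * \<delta> i) = 1"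
    by (simp_all add: hermitian_form_def \<delta> cong: sum.cong_simp)
  moreover have "\<delta> i \<in> algebra_center" for i by (simp add: \<delta>_def center_zero center_one)
  ultimately have p1: "z n n - e *\<^sub>R 1 \<in> positive_cone" using pos[of \<delta>] by simp
  then have "invertible (z n n - e *\<^sub>R 1 + e *\<^sub>R 1)"
    using e by (simp only: positive_cone_iff)
  then obtain q where q: "z n n * q = 1" "q * z n n = 1" unfolding invertible_def by auto
  have "a * z n n = z n n * a" for a
    using cen[of n n] by (simp add: algebra_center_def)
  from inverse_commute[OF q this] have q_cen: "q \<in> algebra_center"
    by (simp add: algebra_center_def)
  have p: "z n n \<in> positive_cone"
    using positive_cone_add[OF p1 positive_cone_scaleR[OF square_positive[of 1], of e]] e by simp
  have q_sa: "q\<^sup>\<star> = q" by (rule inverse_self_adjoint[OF q(1)], rule herm[symmetric]) simp_all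
  define S where "S = (\<lambda>i j. z i j - z i n * q * z n j)"
  define w where "w b = (\<Sum>j<n. z n j * b j)" for b
  have sq: "hermitian_form (Suc n) z b = hermitian_form n S b + (b n + q * w b)\<^sup>\<star> * z n n * (b n + q * w b)" for b
    unfolding S_def w_def by (rule hermitian_form_Suc_complete_square[where z = z and n = n, OF _ q], rule herm)
  have "hermitian_form n S b \<in> positive_cone"
  proof (rule Suc.IH)
    fix i j assume ij: "i < n" "j < n"
    show "S i j \<in> algebra_center"
      unfolding S_def using ij by (intro center_diff center_mult cen q_cen) auto
    show "S j i = (S i j)\<^sup>\<star>"
    proof -
      have "z j i = (z i j)\<^sup>\<star>" "z j n = (z n j)\<^sup>\<star>" "z n i = (z i n)\<^sup>\<star>"
        using ij by (auto intro: herm)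
      then show ?thesis by (simp only: S_def star_diff star_mult q_sa mult.assoc)
    qed
  next
    fix d :: "nat \<Rightarrow> 'a" assume d: "\<And>i. i < n \<Longrightarrow> d i \<in> algebra_center"
    define d' where "d' = d(n := - (q * w d))"
    have "w d \<in> algebra_center"
      unfolding w_def using d cen by (intro center_sum center_mult) auto
    then have d'c: "d' i \<in> algebra_center" if "i < Suc n" for i
      using that d q_cen by (auto simp: d'_def less_Suc_eq intro: center_minus center_mult)
    have eq: "w d' = w d" "hermitian_form n S d' = hermitian_form n S d"
        "(\<Sum>i<n. (d' i)\<^sup>\<star> * d' i) = (\<Sum>i<n. (d i)\<^sup>\<star> * d i)"
      by (auto simp: w_def hermitian_form_def d'_def intro!: sum.cong)
    \<comment> \<open>With this last entry, the square completed by \<open>sq\<close> is zero.\<close>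
    have "hermitian_form (Suc n) z d' = hermitian_form n S d"
      unfolding sq eq by (simp add: d'_def)
    then have "hermitian_form n S d - e *\<^sub>R (\<Sum>i<n. (d i)\<^sup>\<star> * d i) =
        (hermitian_form (Suc n) z d' - e *\<^sub>R (\<Sum>i<Suc n. (d' i)\<^sup>\<star> * d' i)) + e *\<^sub>R ((d' n)\<^sup>\<star> * d' n)"
      by (simp add: eq scaleR_add_right)
    also have "\<dots> \<in> positive_cone"
      using e by (intro positive_cone_add pos d'c positive_cone_scaleR star_mult_self_positive) auto
    finally show "hermitian_form n S d - e *\<^sub>R (\<Sum>i<n. (d i)\<^sup>\<star> * d i) \<in> positive_cone" .
  qed
  then show ?case unfolding sq by (intro positive_cone_add positive_cone_conjugate p)
qed

text \<open>
  Adding \<open>e\<close> to the diagonal makes the form strictly positive; then \<open>e\<close> tends to \<open>0\<close>.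
\<close>

lemma hermitian_form_positive:
  assumes cen: "\<And>i j. i < n \<Longrightarrow> j < n \<Longrightarrow> z i j \<in> algebra_center"
    and herm: "\<And>i j. i < n \<Longrightarrow> j < n \<Longrightarrow> z j i = (z i j)\<^sup>\<star>"
    and pos: "\<And>d. (\<And>i. i < n \<Longrightarrow> d i \<in> algebra_center) \<Longrightarrow> hermitian_form n z d \<in> positive_cone"
  shows "hermitian_form n z b \<in> positive_cone"
proof (rule positive_cone_limit)
  fix e :: real assume e: "e > 0"
  define z' where "z' = (\<lambda>i j. z i j + (if i = j then e *\<^sub>R 1 else 0))"
  have eq: "hermitian_form n z' d = hermitian_form n z d + e *\<^sub>R (\<Sum>i<n. (d i)\<^sup>\<star> * d i)" for d
  proof -
    have "(d i)\<^sup>\<star> * z' i j * d j = (d i)\<^sup>\<star> * z i j * d j + (if i = j then e *\<^sub>R ((d i)\<^sup>\<star> * d i) else 0)"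
      for i j by (simp add: z'_def distrib_left distrib_right)
    then show ?thesis by (simp add: hermitian_form_def sum.distrib scaleR_sum_right)
  qed
  have "hermitian_form n z' b \<in> positive_cone"
  proof (rule hermitian_form_positive_strict[OF _ _ e])
    fix i j assume ij: "i < n" "j < n"
    have "x + e *\<^sub>R 1 \<in> algebra_center" if "x \<in> algebra_center" for x :: 'a
      using that by (simp add: algebra_center_def distrib_left distrib_right)
    then show "z' i j \<in> algebra_center" using cen[OF ij] by (cases "i = j") (auto simp: z'_def)
    show "z' j i = (z' i j)\<^sup>\<star>" using herm[OF ij] by (simp add: z'_def star_add star_scaleR)
  next
    fix d :: "nat \<Rightarrow> 'a" assume "\<And>i. i < n \<Longrightarrow> d i \<in> algebra_center"
    then show "hermitian_form n z' d - e *\<^sub>R (\<Sum>i<n. (d i)\<^sup>\<star> * d i) \<in> positive_cone"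
      by (simp add: eq pos)
  qed
  then show "hermitian_form n z b + e *\<^sub>R (\<Sum>i<n. (b i)\<^sup>\<star> * b i) \<in> positive_cone" by (simp add: eq)
qed

section \<open>Gram matrices and cocycles in a Hilbert module\<close>

context hilbert_module
begin

lemma ip_add_right: "ip x (y + y') = ip x y + ip x y'"
  using inner_linear[of x] unfolding clinear_iff by blast

lemma ip_minus_right: "ip x (- y) = - ip x y"
proof -
  have "ip x ((- 1) *\<^sub>C y) = (- 1) *\<^sub>C ip x y"
    using inner_linear[of x] unfolding clinear_iff by blast
  then show ?thesis by simp
qed

lemma ip_zero_right: "ip x 0 = 0"
  using ip_add_right[of x 0 0] by simp

lemma ip_sum_right: "ip x (\<Sum>i\<in>I. f i) = (\<Sum>i\<in>I. ip x (f i))"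
  by (induction I rule: infinite_finite_induct) (simp_all add: ip_add_right ip_zero_right)

lemma star_ip: "(ip x y)\<^sup>\<star> = ip y x"
  by (rule inner_star[symmetric])

lemma ip_add_left: "ip (x + x') y = ip x y + ip x' y"
  using arg_cong[OF ip_add_right[of y x x'], of star] by (simp only: star_add star_ip)

lemma ip_minus_left: "ip (- x) y = - ip x y"
  using arg_cong[OF ip_minus_right[of y x], of star] by (simp only: star_minus star_ip)

lemma ip_sum_left: "ip (\<Sum>i\<in>I. f i) y = (\<Sum>i\<in>I. ip (f i) y)"
  using arg_cong[OF ip_sum_right[of y f I], of star] by (simp only: star_sum star_ip)

lemma ip_act_left: "ip (act x a) y = a\<^sup>\<star> * ip x y"
  using arg_cong[OF inner_act[of y x a], of star] by (simp only: star_mult star_ip)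

lemma ip_diff_self: "ip (x - y) (x - y) = ip x x - ip x y - ip y x + ip y y"
  unfolding diff_conv_add_uminus ip_add_left ip_add_right ip_minus_left ip_minus_right by simp

lemma hermitian_form_gram_eq:
  "hermitian_form n (\<lambda>i j. ip (x i) (x j)) b = ip (\<Sum>i<n. act (x i) (b i)) (\<Sum>i<n. act (x i) (b i))"
  unfolding hermitian_form_def ip_sum_left by (simp add: ip_sum_right inner_act ip_act_left mult.assoc)

lemma hermitian_form_gram_positive: "hermitian_form n (\<lambda>i j. ip (x i) (x j)) b \<in> positive_cone"
  unfolding hermitian_form_gram_eq by (rule inner_positive)

text \<open>
  For central vectors \<open>d\<close> everything commutes, and the transposed form at \<open>d\<close> is the Gram form at
  \<open>d\<^sup>\<star>\<close>. Positivity at arbitrary vectors then comes from \<open>hermitian_form_positive\<close>.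
\<close>

lemma hermitian_form_transposed_gram_positive:
  assumes cen: "\<And>i j. i < n \<Longrightarrow> j < n \<Longrightarrow> ip (x i) (x j) \<in> algebra_center"
  shows "hermitian_form n (\<lambda>i j. ip (x j) (x i)) b \<in> positive_cone"
proof (rule hermitian_form_positive)
  fix d :: "nat \<Rightarrow> 'a" assume d: "\<And>i. i < n \<Longrightarrow> d i \<in> algebra_center"
  have "(d i)\<^sup>\<star> * ip (x j) (x i) * d j = ((d j)\<^sup>\<star>)\<^sup>\<star> * ip (x j) (x i) * (d i)\<^sup>\<star>"
    if "i < n" "j < n" for i j
  proof -
    have "(d i)\<^sup>\<star> * a = a * (d i)\<^sup>\<star>" "d j * a = a * d j" for a
      using center_star[OF d[OF that(1)]] d[OF that(2)] by (simp_all add: algebra_center_def)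
    then show ?thesis by (metis mult.assoc star_star)
  qed
  then have "hermitian_form n (\<lambda>i j. ip (x j) (x i)) d =
      (\<Sum>i<n. \<Sum>j<n. ((d j)\<^sup>\<star>)\<^sup>\<star> * ip (x j) (x i) * (d i)\<^sup>\<star>)"
    unfolding hermitian_form_def by (intro sum.cong refl) auto
  also have "\<dots> = hermitian_form n (\<lambda>i j. ip (x i) (x j)) (\<lambda>i. (d i)\<^sup>\<star>)"
    unfolding hermitian_form_def by (rule sum.swap)
  finally show "hermitian_form n (\<lambda>i j. ip (x j) (x i)) d \<in> positive_cone"
    by (simp add: hermitian_form_gram_positive)
qed (simp_all add: cen star_ip)

text \<open>
  The terms \<open>\<langle>x\<^sub>j, x\<^sub>j\<rangle>\<close> and \<open>\<langle>x\<^sub>i, x\<^sub>i\<rangle>\<close> of the expansion each leave one of the outer sums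
  \<open>\<Sum> b\<^sub>i\<^sup>\<star>\<close>, \<open>\<Sum> b\<^sub>j\<close> free, and both of these vanish.
\<close>

lemma distance_form_eq:
  assumes b: "(\<Sum>i<n. b i) = 0"
  shows "(\<Sum>i<n. \<Sum>j<n. (b i)\<^sup>\<star> * ip (x j - x i) (x j - x i) * b j) =
    - (hermitian_form n (\<lambda>i j. ip (x i) (x j)) b + hermitian_form n (\<lambda>i j. ip (x j) (x i)) b)"
proof -
  have bs: "(\<Sum>i<n. (b i)\<^sup>\<star>) = 0" using arg_cong[OF b, of star] by (simp add: star_sum)
  have "(\<Sum>i<n. \<Sum>j<n. (b i)\<^sup>\<star> * ip (x j) (x j) * b j) =
      (\<Sum>i<n. (b i)\<^sup>\<star>) * (\<Sum>j<n. ip (x j) (x j) * b j)"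
    by (simp add: sum_product mult.assoc)
  then have 1: "(\<Sum>i<n. \<Sum>j<n. (b i)\<^sup>\<star> * ip (x j) (x j) * b j) = 0" by (simp add: bs)
  have "(\<Sum>i<n. \<Sum>j<n. (b i)\<^sup>\<star> * ip (x i) (x i) * b j) =
      (\<Sum>i<n. (b i)\<^sup>\<star> * ip (x i) (x i)) * (\<Sum>j<n. b j)"
    by (simp add: sum_product)
  then have 2: "(\<Sum>i<n. \<Sum>j<n. (b i)\<^sup>\<star> * ip (x i) (x i) * b j) = 0" by (simp add: b)
  show ?thesis
    unfolding ip_diff_self hermitian_form_def
    by (simp add: distrib_left distrib_right left_diff_distrib right_diff_distrib
        sum.distrib sum_subtractf 1 2)
qed

text \<open>
  What the symmetric and the central case share. The assumption \<open>trans\<close>, positivity of the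
  transposed Gram matrices of the cocycle, is proved differently in the two cases.
\<close>

lemma cocycle_normalized_negative_definite:
  assumes G: "group G" and u: "equivariant_action G \<alpha> act ip u" and c: "one_cocycle G u c"
    and \<psi>: "\<And>g. g \<in> carrier G \<Longrightarrow> \<psi> g = ip (c g) (c g)"
    and trans: "\<And>(n::nat) \<gamma> b. \<gamma> \<in> {..<n} \<rightarrow> carrier G \<Longrightarrow>
      hermitian_form n (\<lambda>i j. ip (c (\<gamma> j)) (c (\<gamma> i))) b \<in> positive_cone"
  shows "normalized G \<psi>" and "negative_definite G \<alpha> \<psi>"
proof -
  interpret group G by (rule G)
  have \<alpha>: "\<alpha> g (ip x y) = ip (u g x) (u g y)" if "g \<in> carrier G" for g x y
    using u that unfolding equivariant_action_def by blast
  have cc: "c (g \<otimes>\<^bsub>G\<^esub> h) = c g + u g (c h)" if "g \<in> carrier G" "h \<in> carrier G" for g h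
    using c that unfolding one_cocycle_def by blast
  have iso: "u g \<in> carrier isometry_group" if "g \<in> carrier G" for g
    using u that unfolding equivariant_action_def hom_def by auto
  have inj: "u g x = u g y \<Longrightarrow> x = y" if "g \<in> carrier G" for g x y
    using iso[OF that] by (auto simp: isometry_group_def bij_def inj_def)
  have u0: "u g 0 = 0" if "g \<in> carrier G" for g
  proof -
    have "norm (u g 0) = norm (0::'x)" using iso[OF that] by (simp add: isometry_group_def)
    then show ?thesis by simp
  qed
  have "c \<one>\<^bsub>G\<^esub> = c \<one>\<^bsub>G\<^esub> + u \<one>\<^bsub>G\<^esub> (c \<one>\<^bsub>G\<^esub>)" using cc[of "\<one>\<^bsub>G\<^esub>" "\<one>\<^bsub>G\<^esub>"] by simp
  then have c1: "c \<one>\<^bsub>G\<^esub> = 0" using inj[of "\<one>\<^bsub>G\<^esub>" _ 0] u0[of "\<one>\<^bsub>G\<^esub>"] by simp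
  then show "normalized G \<psi>" by (simp add: normalized_def \<psi> ip_zero_right)
  have uinv: "u g (c (inv\<^bsub>G\<^esub> g \<otimes>\<^bsub>G\<^esub> h)) = c h - c g" if "g \<in> carrier G" "h \<in> carrier G" for g h
    using cc[of g "inv\<^bsub>G\<^esub> g \<otimes>\<^bsub>G\<^esub> h"] that by (simp add: m_assoc[symmetric])
  have \<alpha>\<psi>: "\<alpha> g (\<psi> (inv\<^bsub>G\<^esub> g \<otimes>\<^bsub>G\<^esub> h)) = ip (c h - c g) (c h - c g)"
    if "g \<in> carrier G" "h \<in> carrier G" for g h
    using that by (simp add: \<psi> \<alpha> uinv)
  show "negative_definite G \<alpha> \<psi>"
    unfolding negative_definite_def
  proof (intro conjI ballI allI impI)
    fix g assume g: "g \<in> carrier G"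
    have "\<alpha> g (\<psi> (inv\<^bsub>G\<^esub> g)) = ip (c g) (c g)"
      using \<alpha>\<psi>[OF g one_closed] g by (simp add: c1 ip_minus_left ip_minus_right)
    then show "\<alpha> g (\<psi> (inv\<^bsub>G\<^esub> g)) = (\<psi> g)\<^sup>\<star>" using g by (simp add: \<psi> star_ip)
  next
    fix n :: nat and \<gamma> :: "nat \<Rightarrow> 'b" and b :: "nat \<Rightarrow> 'a"
    assume \<gamma>: "\<gamma> \<in> {..<n} \<rightarrow> carrier G" and b: "(\<Sum>i<n. b i) = 0"
    let ?x = "\<lambda>i. c (\<gamma> i)"
    have "(\<Sum>i<n. \<Sum>j<n. (b i)\<^sup>\<star> * \<alpha> (\<gamma> i) (\<psi> (inv\<^bsub>G\<^esub> (\<gamma> i) \<otimes>\<^bsub>G\<^esub> \<gamma> j)) * b j) =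
        (\<Sum>i<n. \<Sum>j<n. (b i)\<^sup>\<star> * ip (?x j - ?x i) (?x j - ?x i) * b j)"
      using \<gamma> by (intro sum.cong refl) (auto simp: \<alpha>\<psi> Pi_iff)
    also have "\<dots> = - (hermitian_form n (\<lambda>i j. ip (?x i) (?x j)) b + hermitian_form n (\<lambda>i j. ip (?x j) (?x i)) b)"
      by (rule distance_form_eq[OF b])
    finally show "(\<Sum>i<n. \<Sum>j<n. (b i)\<^sup>\<star> * \<alpha> (\<gamma> i) (\<psi> (inv\<^bsub>G\<^esub> (\<gamma> i) \<otimes>\<^bsub>G\<^esub> \<gamma> j)) * b j) \<le>\<^sub>A 0"
      unfolding cstar_le_def by (simp add: positive_cone_add hermitian_form_gram_positive trans[OF \<gamma>])
  qed
qed

end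

theorem proposition3p16:
  fixes G :: "('g, 'm) monoid_scheme"
    and \<alpha> :: "'g \<Rightarrow> 'a::cstar_algebra_1 \<Rightarrow> 'a"
    and act :: "'x::cbanach \<Rightarrow> 'a \<Rightarrow> 'x"
    and ip :: "'x \<Rightarrow> 'x \<Rightarrow> 'a"
    and u :: "'g \<Rightarrow> 'x \<Rightarrow> 'x"
    and c :: "'g \<Rightarrow> 'x"
    and \<psi> :: "'g \<Rightarrow> 'a"
  assumes "group G"
    and "\<alpha> \<in> hom G Aut_group"
    and "hilbert_module act ip"
    and "equivariant_action G \<alpha> act ip u"
    and "one_cocycle G u c"
    and "\<And>g. g \<in> carrier G \<Longrightarrow> \<psi> g = ip (c g) (c g)"
  shows "(symmetric_cocycle G ip c \<longrightarrow>
            \<psi> \<in> carrier G \<rightarrow> positive_cone \<and>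
            normalized G \<psi> \<and> negative_definite G \<alpha> \<psi>) \<and>
         (central_cocycle G ip c \<longrightarrow>
            \<psi> \<in> carrier G \<rightarrow> algebra_center \<inter> positive_cone \<and>
            normalized G \<psi> \<and> negative_definite G \<alpha> \<psi>)"
proof -
  interpret hilbert_module act ip by (rule assms(3))
  have sym: "hermitian_form n (\<lambda>i j. ip (c (\<gamma> j)) (c (\<gamma> i))) b \<in> positive_cone"
    if "symmetric_cocycle G ip c" "\<gamma> \<in> {..<n} \<rightarrow> carrier G" for n :: nat and \<gamma> b
  proof -
    have "ip (c (\<gamma> j)) (c (\<gamma> i)) = ip (c (\<gamma> i)) (c (\<gamma> j))" if "i < n" "j < n" for i j
      using \<open>symmetric_cocycle G ip c\<close> \<open>\<gamma> \<in> _\<close> that inner_star[of "c (\<gamma> j)" "c (\<gamma> i)"]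
      by (auto simp: symmetric_cocycle_def self_adjoint_part_def Pi_iff)
    then have "hermitian_form n (\<lambda>i j. ip (c (\<gamma> j)) (c (\<gamma> i))) b = hermitian_form n (\<lambda>i j. ip (c (\<gamma> i)) (c (\<gamma> j))) b"
      by (simp add: hermitian_form_def)
    then show ?thesis by (simp add: hermitian_form_gram_positive)
  qed
  have cen: "hermitian_form n (\<lambda>i j. ip (c (\<gamma> j)) (c (\<gamma> i))) b \<in> positive_cone"
    if "central_cocycle G ip c" "\<gamma> \<in> {..<n} \<rightarrow> carrier G" for n :: nat and \<gamma> b
    using that by (intro hermitian_form_transposed_gram_positive) (auto simp: central_cocycle_def Pi_iff)
  note main = cocycle_normalized_negative_definite[OF assms(1,4,5,6)]
  have "\<psi> \<in> carrier G \<rightarrow> positive_cone" by (simp add: assms(6) inner_positive)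
  moreover have "\<psi> \<in> carrier G \<rightarrow> algebra_center" if "central_cocycle G ip c"
    using that by (auto simp: assms(6) central_cocycle_def)
  ultimately show ?thesis using main[OF _ sym] main[OF _ cen] by blast
qed

end
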